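(* Let $I\subset\mathbb{R}$ be an interval, let $f:I\to\mathbb{R}$ be differentiable on the interior $I^\circ$ of $I$, let $a,b\in I$ with $0\le a<b$, and suppose $f'\in L_1[a,b]$. Let $\alpha\ge 1$ and $x\in(a,b)$. Then $$f(x)=\frac{\Gamma(\alpha)}{b-a}(b-x)^{1-\alpha}J_a^{\alpha}f(b)-J_a^{\alpha-1}\big(P_2(x,b)f(b)\big)+J_a^{\alpha}\big(P_2(x,b)f'(b)\big),$$ where $$P_2(x,t)=\begin{cases}\dfrac{t-a}{b-a}(b-x)^{1-\alpha}\,\Gamma(\alpha), & a\le t<x,\\[2mm] \dfrac{t-b}{b-a}(b-x)^{1-\alpha}\,\Gamma(\alpha), & x\le t\le b.\end{cases}$$
   Context: For $\beta\ge 0$ and $a\ge0$ the Riemann-Liouville fractional integral is $J_a^{\beta}g(y)=\frac{1}{\Gamma(\beta)}\int_a^y (y-t)^{\beta-1}g(t)\,dt$ if $\beta>0$, and $J_a^0g(y)=g(y)$. The notation $J_a^{\beta}(P_2(x,b)g(b))$ means $J_a^\beta$ applied to the function $t\mapsto P_2(x,t)g(t)$ and evaluated at $b$ (with $x$ fixed): for $\beta>0$ it equals $\frac{1}{\Gamma(\beta)}\int_a^b (b-t)^{\beta-1}P_2(x,t)g(t)\,dt$. For $\beta=0$ it equals $P_2(x,b)g(b)$; in particular, when $\alpha=1$ the term $J_a^{\alpha-1}(P_2(x,b)f(b))=P_2(x,b)f(b)$ is $0$ since $P_2(x,b)=0$. *)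

theory Defs
  imports "HOL-Analysis.Analysis"
begin

text \<open>
  The Riemann--Liouville fractional integral \<open>J\<^sub>a\<^sup>\<beta> g (y)\<close> is only meant for \<open>\<beta> \<ge> 0\<close> and
  \<open>y \<ge> a\<close>. The convention \<open>0 powr 0 = 0\<close> affects the integrand at most at the null
  point \<open>t = y\<close> (when \<open>\<beta> = 1\<close>).
\<close>

definition RL_integral :: "real \<Rightarrow> real \<Rightarrow> (real \<Rightarrow> real) \<Rightarrow> real \<Rightarrow> real" where
  "RL_integral \<beta> a g y =
     (if \<beta> = 0 then g y
      else 1 / Gamma \<beta> * (LINT t:{a..y}|lebesgue. (y - t) powr (\<beta> - 1) * g t))"

text \<open>
  The kernel is only meant for \<open>a \<le> t \<le> b\<close>. Its dependence on \<open>\<alpha>\<close>, \<open>a\<close>, \<open>b\<close>, which is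
  usually suppressed in the notation \<open>P\<^sub>2(x,t)\<close>, is explicit here.
\<close>

definition P2 :: "real \<Rightarrow> real \<Rightarrow> real \<Rightarrow> real \<Rightarrow> real \<Rightarrow> real" where
  "P2 \<alpha> a b x t =
     (if t < x then (t - a) / (b - a) * (b - x) powr (1 - \<alpha>) * Gamma \<alpha>
      else (t - b) / (b - a) * (b - x) powr (1 - \<alpha>) * Gamma \<alpha>)"

end

theory Submission
  imports Defs
begin

text \<open>
  The identity is integration by parts against the kernel \<open>(b - t) powr (\<alpha> - 1) * P2 \<alpha> a b x t\<close>,
  done separately on \<open>[a, x]\<close> and \<open>[x, b]\<close>. Up to the common constant
  \<open>(b - x) powr (1 - \<alpha>) * Gamma \<alpha> / (b - a)\<close>, this kernel is \<open>u t = (b - t) powr (\<alpha> - 1) * (t - a)\<close>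
  to the left of \<open>x\<close> and \<open>v t = - (b - t) powr \<alpha>\<close> to the right. Since \<open>u\<close> vanishes at \<open>a\<close> and \<open>v\<close>
  at \<open>b\<close>, only the jump at \<open>x\<close> contributes a boundary term, namely
  \<open>(u x - v x) * f x = (b - x) powr (\<alpha> - 1) * (b - a) * f x\<close>, and the normalization of the kernel
  turns this into \<open>f x\<close>. On both sides of \<open>x\<close> the derivative of the kernel has the form
  \<open>(b - t) powr (\<alpha> - 1) - (\<alpha> - 1) * (b - t) powr (\<alpha> - 2) * p t\<close>, where \<open>p t\<close> is \<open>t - a\<close> on the
  left and \<open>t - b\<close> on the right. The first summand is the weight of the fractional integral of
  \<open>f\<close>, the second is that of the fractional integral of order \<open>\<alpha> - 1\<close>, whose factor \<open>\<alpha> - 1\<close> is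
  absorbed by \<open>Gamma \<alpha> = (\<alpha> - 1) * Gamma (\<alpha> - 1)\<close> when \<open>\<alpha> > 1\<close>,
  while for \<open>\<alpha> = 1\<close> the term vanishes on both sides (\<open>RL_integral_pred\<close>).

  At \<open>a\<close> and \<open>b\<close> the function \<open>f\<close> may be discontinuous if they are endpoints of \<open>I\<close>.
  Integrability of the derivative however gives \<open>f\<close> finite one-sided limits there
  (\<open>continuous_extension_of_integrable_derivative\<close>). Integration by parts is applied to the
  resulting continuous extension, and \<open>set_lebesgue_integral_split\<close> ignores the null set
  \<open>{a, x, b}\<close> on which the pieces may differ from the original integrands.
\<close>

section \<open>Integrals on adjacent intervals\<close>

text \<open>
  Since the three boundary points form a null set, a kernel given by cases, or one with
  exceptional values there, can be replaced by the two formulas that hold inside the pieces.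
\<close>

lemma set_lebesgue_integral_split:
  fixes k p q :: "real \<Rightarrow> real"
  assumes "a < x" "x < b"
    and p: "p absolutely_integrable_on {a..x}" and q: "q absolutely_integrable_on {x..b}"
    and kp: "\<And>t. a < t \<Longrightarrow> t < x \<Longrightarrow> k t = p t"
    and kq: "\<And>t. x < t \<Longrightarrow> t < b \<Longrightarrow> k t = q t"
  shows "(LINT t:{a..b}|lebesgue. k t) = (LINT t:{a..x}|lebesgue. p t) + (LINT t:{x..b}|lebesgue. q t)"
proof -
  have "(LINT t:{a..b}|lebesgue. k t)
      = (LINT t|lebesgue. indicat_real {a..x} t *\<^sub>R p t + indicat_real {x..b} t *\<^sub>R q t)"
    unfolding set_lebesgue_integral_def
    by (rule integral_discrete_difference[where X = "{a, x, b}"])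
       (use assms(1,2) kp kq in \<open>auto simp: indicator_def\<close>)
  also have "\<dots> = (LINT t:{a..x}|lebesgue. p t) + (LINT t:{x..b}|lebesgue. q t)"
    using p q unfolding set_lebesgue_integral_def set_integrable_def
    by (rule Bochner_Integration.integral_add)
  finally show ?thesis .
qed

lemma absolutely_integrable_mult_continuous:
  fixes w g :: "real \<Rightarrow> real"
  assumes "w absolutely_integrable_on {c..d}" "continuous_on {c..d} g"
  shows "(\<lambda>t. w t * g t) absolutely_integrable_on {c..d}"
    and "(\<lambda>t. g t * w t) absolutely_integrable_on {c..d}"
proof -
  have "g \<in> borel_measurable (lebesgue_on {c..d})"
    using assms(2) by (intro continuous_imp_measurable_on_sets_lebesgue) auto
  moreover have "bounded (g ` {c..d})"
    using assms(2) by (intro compact_imp_bounded compact_continuous_image) auto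
  ultimately show "(\<lambda>t. g t * w t) absolutely_integrable_on {c..d}"
    using assms(1) by (intro absolutely_integrable_bounded_measurable_product_real) auto
  then show "(\<lambda>t. w t * g t) absolutely_integrable_on {c..d}"
    by (simp add: mult.commute)
qed

lemma absolutely_integrable_by_parts:
  fixes u v u' v' :: "real \<Rightarrow> real"
  assumes "c \<le> d"
    and cont: "continuous_on {c..d} u" "continuous_on {c..d} v"
    and der_u: "\<And>t. t \<in> {c<..<d} \<Longrightarrow> (u has_real_derivative u' t) (at t)"
    and der_v: "\<And>t. t \<in> {c<..<d} \<Longrightarrow> (v has_real_derivative v' t) (at t)"
    and int: "u' absolutely_integrable_on {c..d}" "v' absolutely_integrable_on {c..d}"
  shows "(LINT t:{c..d}|lebesgue. u' t * v t) + (LINT t:{c..d}|lebesgue. u t * v' t)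
       = u d * v d - u c * v c"
proof -
  have int1: "(\<lambda>t. u' t * v t) absolutely_integrable_on {c..d}"
    and int2: "(\<lambda>t. u t * v' t) absolutely_integrable_on {c..d}"
    using absolutely_integrable_mult_continuous cont int by blast+
  have "((\<lambda>t. u' t * v t + u t * v' t) has_integral (u d * v d - u c * v c)) {c..d}"
  proof (rule fundamental_theorem_of_calculus_interior)
    show "continuous_on {c..d} (\<lambda>t. u t * v t)"
      by (intro continuous_intros cont)
    show "((\<lambda>t. u t * v t) has_vector_derivative u' t * v t + u t * v' t) (at t)"
      if "t \<in> {c<..<d}" for t
      using DERIV_mult[OF der_u der_v, OF that that]
      by (simp add: has_real_derivative_iff_has_vector_derivative algebra_simps)
  qed (rule assms(1))
  moreover have "((\<lambda>t. u' t * v t + u t * v' t) has_integral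
      (LINT t:{c..d}|lebesgue. u' t * v t) + (LINT t:{c..d}|lebesgue. u t * v' t)) {c..d}"
    by (intro has_integral_add has_integral_set_lebesgue int1 int2)
  ultimately show ?thesis
    by (rule has_integral_unique[symmetric])
qed

section \<open>Functions with an integrable derivative\<close>

text \<open>
  The extension is the indefinite integral of \<open>f'\<close>, normalized to agree with \<open>f\<close> at the midpoint:
  the fundamental theorem of calculus on compact subintervals gives agreement in the whole interior.
\<close>

lemma continuous_extension_of_integrable_derivative:
  fixes f f' :: "real \<Rightarrow> real"
  assumes "a < b"
    and der: "\<And>t. t \<in> {a<..<b} \<Longrightarrow> (f has_real_derivative f' t) (at t)"
    and int: "f' integrable_on {a..b}"
  obtains g where "continuous_on {a..b} g" and "\<And>t. t \<in> {a<..<b} \<Longrightarrow> g t = f t"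
proof -
  define m where "m = (a + b) / 2"
  have m: "a < m" "m < b"
    using assms(1) by (auto simp: m_def)
  define g where "g t = f m + (integral {a..t} f' - integral {a..m} f')" for t
  have incr: "integral {a..s} f' - integral {a..r} f' = f s - f r"
    if "a < r" "r \<le> s" "s < b" for r s
  proof -
    have "(f' has_integral (f s - f r)) {r..s}"
    proof (rule fundamental_theorem_of_calculus)
      show "(f has_vector_derivative f' t) (at t within {r..s})" if "t \<in> {r..s}" for t
        using that der[of t] \<open>a < r\<close> \<open>s < b\<close>
        by (simp add: has_real_derivative_iff_has_vector_derivative has_vector_derivative_at_within)
    qed (rule \<open>r \<le> s\<close>)
    moreover have "f' integrable_on {a..s}"
      by (rule integrable_on_subinterval[OF int]) (use that in auto)
    then have "integral {a..r} f' + integral {r..s} f' = integral {a..s} f'"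
      using that by (intro Henstock_Kurzweil_Integration.integral_combine) auto
    ultimately show ?thesis
      by (auto dest: integral_unique)
  qed
  show thesis
  proof
    show "continuous_on {a..b} g"
      unfolding g_def by (intro continuous_intros indefinite_integral_continuous_1 int)
    show "g t = f t" if "t \<in> {a<..<b}" for t
      using incr[of m t] incr[of t m] that m by (cases "m \<le> t") (auto simp: g_def)
  qed
qed

section \<open>The kernel\<close>

lemma has_real_derivative_powr_diff:
  fixes b t r :: real
  assumes "t < b"
  shows "((\<lambda>t. (b - t) powr r) has_real_derivative - (r * (b - t) powr (r - 1))) (at t)"
  using assms by (auto intro!: derivative_eq_intros)

text \<open>
  For \<open>r = 0\<close> the convention \<open>0 powr 0 = 0\<close> makes the integrand discontinuous at \<open>b\<close>, so the claim
  is reduced to the constant function 1 off that point.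
\<close>

lemma absolutely_integrable_powr_diff:
  fixes b x r :: real
  assumes "0 \<le> r"
  shows "(\<lambda>t. (b - t) powr r) absolutely_integrable_on {x..b}"
proof (cases "r = 0")
  case True
  have "(\<lambda>t. 1 :: real) absolutely_integrable_on {x..b}"
    by (intro absolutely_integrable_continuous_real continuous_intros)
  then show ?thesis
    by (rule absolutely_integrable_spike[where S = "{b}"]) (use True in auto)
next
  case False
  then show ?thesis
    using assms
    by (intro absolutely_integrable_continuous_real continuous_on_powr' continuous_intros) auto
qed

lemma P2_at_right_endpoint:
  assumes "x \<le> b"
  shows "P2 \<alpha> a b x b = 0"
  using assms by (simp add: P2_def)

text \<open>
  At \<open>\<alpha> = 1\<close>, where order \<open>\<alpha> - 1\<close> means point evaluation, both sides vanish because the factor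
  \<open>h b\<close> does; this spares the main proof a case distinction.
\<close>

lemma RL_integral_pred:
  assumes "\<alpha> \<ge> 1" and "\<alpha> = 1 \<Longrightarrow> h b = 0"
  shows "RL_integral (\<alpha> - 1) a h b
       = (\<alpha> - 1) / Gamma \<alpha> * (LINT t:{a..b}|lebesgue. (b - t) powr (\<alpha> - 2) * h t)"
proof (cases "\<alpha> = 1")
  case True
  then show ?thesis using assms by (simp add: RL_integral_def)
next
  case False
  then have "Gamma \<alpha> = (\<alpha> - 1) * Gamma (\<alpha> - 1)"
    using assms(1) Gamma_plus1[of "\<alpha> - 1"] nonpos_Ints_nonpos[of "\<alpha> - 1"] by force
  then show ?thesis
    using False by (simp add: RL_integral_def)
qed

section \<open>The representation formula\<close>

theorem lemma1:
  fixes I :: "real set" and f :: "real \<Rightarrow> real" and a b \<alpha> x :: real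
  assumes "is_interval I"
    and "f differentiable_on interior I"
    and "a \<in> I" and "b \<in> I" and "0 \<le> a" and "a < b"
    and "deriv f absolutely_integrable_on {a..b}"
    and "\<alpha> \<ge> 1" and "x \<in> {a<..<b}"
  shows "f x = Gamma \<alpha> / (b - a) * (b - x) powr (1 - \<alpha>) * RL_integral \<alpha> a f b
               - RL_integral (\<alpha> - 1) a (\<lambda>t. P2 \<alpha> a b x t * f t) b
               + RL_integral \<alpha> a (\<lambda>t. P2 \<alpha> a b x t * deriv f t) b"
proof -
  have x: "a < x" "x < b"
    using assms(9) by auto
  have "{a<..<b} \<subseteq> I"
    using assms(1,3,4) unfolding is_interval_1 by (meson greaterThanLessThan_iff less_imp_le subsetI)
  then have "{a<..<b} \<subseteq> interior I"
    by (simp add: interior_maximal)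
  then have der: "(f has_real_derivative deriv f t) (at t)" if "t \<in> {a<..<b}" for t
    using that assms(2) at_within_open[of t "interior I"]
    by (metis DERIV_deriv_iff_real_differentiable differentiable_on_def open_interior subsetD)
  obtain g where g: "continuous_on {a..b} g" and gf: "\<And>t. t \<in> {a<..<b} \<Longrightarrow> g t = f t"
    using continuous_extension_of_integrable_derivative[OF assms(6) der]
      set_lebesgue_integral_eq_integral(1)[OF assms(7)] by blast
  have der_g: "(g has_real_derivative deriv f t) (at t)" if "t \<in> {a<..<b}" for t
    using has_field_derivative_transform_within_open[OF der[OF that], of "{a<..<b}" g] that gf
    by auto
  have g_left: "continuous_on {a..x} g" and g_right: "continuous_on {x..b} g"
    using g x by (auto elim: continuous_on_subset)
  have f'_left: "deriv f absolutely_integrable_on {a..x}"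
    and f'_right: "deriv f absolutely_integrable_on {x..b}"
    using assms(7) x by (auto elim: set_integrable_subset)

  have powr_left: "continuous_on {a..x} (\<lambda>t. (b - t) powr r)" for r
    using x by (intro continuous_intros) auto
  have powr_right: "continuous_on {x..b} (\<lambda>t. (b - t) powr \<alpha>)"
    using assms(8) by (intro continuous_on_powr' continuous_intros) auto

  define L1 where "L1 = (LINT t:{a..x}|lebesgue. (b - t) powr (\<alpha> - 1) * g t)"
  define L2 where "L2 = (LINT t:{x..b}|lebesgue. (b - t) powr (\<alpha> - 1) * g t)"
  define M where "M = (LINT t:{a..x}|lebesgue. (b - t) powr (\<alpha> - 2) * (t - a) * g t)"
  define N1 where "N1 = (LINT t:{a..x}|lebesgue. (b - t) powr (\<alpha> - 1) * (t - a) * deriv f t)"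
  define N2 where "N2 = (LINT t:{x..b}|lebesgue. (b - t) powr \<alpha> * deriv f t)"
  have int_L1: "(\<lambda>t. (b - t) powr (\<alpha> - 1) * g t) absolutely_integrable_on {a..x}"
    and int_M: "(\<lambda>t. (b - t) powr (\<alpha> - 2) * (t - a) * g t) absolutely_integrable_on {a..x}"
    by (intro absolutely_integrable_continuous_real continuous_on_mult powr_left g_left
        continuous_on_diff continuous_on_id continuous_on_const)+
  have int_N1: "(\<lambda>t. (b - t) powr (\<alpha> - 1) * (t - a) * deriv f t) absolutely_integrable_on {a..x}"
    by (intro absolutely_integrable_mult_continuous(2) f'_left continuous_on_mult powr_left
        continuous_on_diff continuous_on_id continuous_on_const)
  \<comment> \<open>Near \<open>b\<close> the weight \<open>(b - t) powr (\<alpha> - 2)\<close> need not be integrable on its own; there it only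
    occurs multiplied by the factor \<open>b - t\<close> of the kernel, which leaves the exponent \<open>\<alpha> - 1 \<ge> 0\<close>.\<close>
  have int_w: "(\<lambda>t. (b - t) powr (\<alpha> - 1)) absolutely_integrable_on {x..b}"
    using assms(8) by (intro absolutely_integrable_powr_diff) auto
  have int_L2: "(\<lambda>t. (b - t) powr (\<alpha> - 1) * g t) absolutely_integrable_on {x..b}"
    by (intro absolutely_integrable_mult_continuous(1) int_w g_right)
  have int_N2: "(\<lambda>t. (b - t) powr \<alpha> * deriv f t) absolutely_integrable_on {x..b}"
    by (intro absolutely_integrable_mult_continuous(2) f'_right powr_right)

  define c where "c = (b - x) powr (1 - \<alpha>) * Gamma \<alpha> / (b - a)"
  have P2_left: "P2 \<alpha> a b x t = c * (t - a)" if "t < x" for t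
    using that by (simp add: P2_def c_def)
  have P2_right: "P2 \<alpha> a b x t = - c * (b - t)" if "x < t" for t
    using that assms(6) by (simp add: P2_def c_def field_simps)
  have powr_shift: "(b - t) powr (r - 1) * (b - t) = (b - t) powr r" if "t < b" for t r
    using that by (simp add: powr_diff)

  have J_f: "RL_integral \<alpha> a f b = (L1 + L2) / Gamma \<alpha>"
  proof -
    have "(LINT t:{a..b}|lebesgue. (b - t) powr (\<alpha> - 1) * f t) = L1 + L2"
      unfolding L1_def L2_def
      by (rule set_lebesgue_integral_split[OF x int_L1 int_L2]) (use gf x in auto)
    then show ?thesis
      using assms(8) by (simp add: RL_integral_def)
  qed
  have J_Pf: "RL_integral (\<alpha> - 1) a (\<lambda>t. P2 \<alpha> a b x t * f t) b
            = c * (\<alpha> - 1) / Gamma \<alpha> * (M - L2)"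
  proof -
    have "(LINT t:{a..b}|lebesgue. (b - t) powr (\<alpha> - 2) * (P2 \<alpha> a b x t * f t))
        = (LINT t:{a..x}|lebesgue. c * ((b - t) powr (\<alpha> - 2) * (t - a) * g t))
          + (LINT t:{x..b}|lebesgue. - c * ((b - t) powr (\<alpha> - 1) * g t))"
    proof (rule set_lebesgue_integral_split[OF x])
      show "(b - t) powr (\<alpha> - 2) * (P2 \<alpha> a b x t * f t) = - c * ((b - t) powr (\<alpha> - 1) * g t)"
        if "x < t" "t < b" for t
        using that x gf[of t] powr_shift[of t "\<alpha> - 1"] by (simp add: P2_right)
      show "(\<lambda>t. - c * ((b - t) powr (\<alpha> - 1) * g t)) absolutely_integrable_on {x..b}"
        by (rule set_integrable_mult_right) (rule int_L2)
      show "(\<lambda>t. c * ((b - t) powr (\<alpha> - 2) * (t - a) * g t)) absolutely_integrable_on {a..x}"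
        by (rule set_integrable_mult_right) (rule int_M)
    qed (use gf x P2_left in simp)
    also have "\<dots> = c * (M - L2)"
      by (simp only: set_integral_mult_right M_def L2_def) (simp add: algebra_simps)
    finally show ?thesis
      using assms(8) x by (subst RL_integral_pred) (auto simp: P2_at_right_endpoint)
  qed
  have J_Pf': "RL_integral \<alpha> a (\<lambda>t. P2 \<alpha> a b x t * deriv f t) b = c / Gamma \<alpha> * (N1 - N2)"
  proof -
    have "(LINT t:{a..b}|lebesgue. (b - t) powr (\<alpha> - 1) * (P2 \<alpha> a b x t * deriv f t))
        = (LINT t:{a..x}|lebesgue. c * ((b - t) powr (\<alpha> - 1) * (t - a) * deriv f t))
          + (LINT t:{x..b}|lebesgue. - c * ((b - t) powr \<alpha> * deriv f t))"
    proof (rule set_lebesgue_integral_split[OF x])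
      show "(b - t) powr (\<alpha> - 1) * (P2 \<alpha> a b x t * deriv f t) = - c * ((b - t) powr \<alpha> * deriv f t)"
        if "x < t" "t < b" for t
        using that powr_shift[of t \<alpha>, symmetric] by (simp add: P2_right)
      show "(\<lambda>t. - c * ((b - t) powr \<alpha> * deriv f t)) absolutely_integrable_on {x..b}"
        by (rule set_integrable_mult_right) (rule int_N2)
      show "(\<lambda>t. c * ((b - t) powr (\<alpha> - 1) * (t - a) * deriv f t)) absolutely_integrable_on {a..x}"
        by (rule set_integrable_mult_right) (rule int_N1)
    qed (use P2_left in simp)
    also have "\<dots> = c * (N1 - N2)"
      by (simp only: set_integral_mult_right N1_def N2_def) (simp add: algebra_simps)
    finally show ?thesis
      using assms(8) by (simp add: RL_integral_def)
  qed

  \<comment> \<open>The boundary term at \<open>a\<close> vanishes because of the factor \<open>t - a\<close>, the one at \<open>b\<close> below because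
    \<open>\<alpha> > 0\<close>.\<close>
  have parts_left: "L1 - (\<alpha> - 1) * M + N1 = (b - x) powr (\<alpha> - 1) * (x - a) * f x"
  proof -
    have "(LINT t:{a..x}|lebesgue.
             ((b - t) powr (\<alpha> - 1) - (\<alpha> - 1) * ((b - t) powr (\<alpha> - 2) * (t - a))) * g t) + N1
        = (b - x) powr (\<alpha> - 1) * (x - a) * g x - (b - a) powr (\<alpha> - 1) * (a - a) * g a"
      unfolding N1_def
    proof (rule absolutely_integrable_by_parts)
      show "((\<lambda>t. (b - t) powr (\<alpha> - 1) * (t - a)) has_real_derivative
          (b - t) powr (\<alpha> - 1) - (\<alpha> - 1) * ((b - t) powr (\<alpha> - 2) * (t - a))) (at t)"
        if "t \<in> {a<..<x}" for t
      proof -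
        have "t < b" using that x by auto
        then show ?thesis
          by (auto intro!: derivative_eq_intros has_real_derivative_powr_diff)
      qed
    qed (use x der_g f'_left in
        \<open>auto intro!: absolutely_integrable_continuous_real continuous_intros g_left\<close>)
    moreover have "(LINT t:{a..x}|lebesgue.
             ((b - t) powr (\<alpha> - 1) - (\<alpha> - 1) * ((b - t) powr (\<alpha> - 2) * (t - a))) * g t)
        = L1 - (\<alpha> - 1) * M"
    proof -
      have "(LINT t:{a..x}|lebesgue.
             ((b - t) powr (\<alpha> - 1) - (\<alpha> - 1) * ((b - t) powr (\<alpha> - 2) * (t - a))) * g t)
          = (LINT t:{a..x}|lebesgue.
             (b - t) powr (\<alpha> - 1) * g t - (\<alpha> - 1) * ((b - t) powr (\<alpha> - 2) * (t - a) * g t))"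
        by (simp add: algebra_simps)
      also have "\<dots> = L1 - (LINT t:{a..x}|lebesgue. (\<alpha> - 1) * ((b - t) powr (\<alpha> - 2) * (t - a) * g t))"
        unfolding L1_def
        by (intro set_integral_diff(2) int_L1 set_integrable_mult_right int_M)
      also have "\<dots> = L1 - (\<alpha> - 1) * M"
        by (simp only: set_integral_mult_right M_def)
      finally show ?thesis .
    qed
    ultimately show ?thesis
      using gf[of x] x by simp
  qed
  have parts_right: "N2 - \<alpha> * L2 = - ((b - x) powr \<alpha> * f x)"
  proof -
    have "(LINT t:{x..b}|lebesgue. - \<alpha> * (b - t) powr (\<alpha> - 1) * g t) + N2
        = (b - b) powr \<alpha> * g b - (b - x) powr \<alpha> * g x"
      unfolding N2_def
    proof (rule absolutely_integrable_by_parts)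
      show "((\<lambda>t. (b - t) powr \<alpha>) has_real_derivative - \<alpha> * (b - t) powr (\<alpha> - 1)) (at t)"
        if "t \<in> {x<..<b}" for t
        using that has_real_derivative_powr_diff[of t b \<alpha>] by simp
      show "(\<lambda>t. - \<alpha> * (b - t) powr (\<alpha> - 1)) absolutely_integrable_on {x..b}"
        by (rule set_integrable_mult_right) (rule int_w)
    qed (use x der_g f'_right g_right powr_right in auto)
    moreover have "(LINT t:{x..b}|lebesgue. - \<alpha> * (b - t) powr (\<alpha> - 1) * g t) = - \<alpha> * L2"
      using set_integral_mult_right[of lebesgue "{x..b}" "- \<alpha>" "\<lambda>t. (b - t) powr (\<alpha> - 1) * g t"]
      by (simp add: L2_def mult.assoc)
    ultimately show ?thesis
      using gf[of x] x by simp
  qed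

  have Gam: "Gamma \<alpha> \<noteq> 0"
    using assms(8) Gamma_real_pos[of \<alpha>] by fastforce
  have "Gamma \<alpha> / (b - a) * (b - x) powr (1 - \<alpha>) * RL_integral \<alpha> a f b
        - RL_integral (\<alpha> - 1) a (\<lambda>t. P2 \<alpha> a b x t * f t) b
        + RL_integral \<alpha> a (\<lambda>t. P2 \<alpha> a b x t * deriv f t) b
      = c / Gamma \<alpha> * ((L1 - (\<alpha> - 1) * M + N1) - (N2 - \<alpha> * L2))"
  proof -
    have "Gamma \<alpha> / (b - a) * (b - x) powr (1 - \<alpha>) = c"
      by (simp add: c_def)
    then show ?thesis
      unfolding J_f J_Pf J_Pf' using Gam by (simp add: field_simps)
  qed
  also have "\<dots> = c / Gamma \<alpha> * ((b - x) powr (\<alpha> - 1) * (b - a) * f x)"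
    unfolding parts_left parts_right powr_shift[OF x(2), of \<alpha>, symmetric]
    by (simp add: algebra_simps)
  also have "\<dots> = (b - x) powr (1 - \<alpha>) * (b - x) powr (\<alpha> - 1) * f x"
    using Gam assms(6) by (simp add: c_def)
  also have "\<dots> = f x"
    using x by (simp flip: powr_add)
  finally show ?thesis ..
qed

end
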